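(* Let $T$ be a real task with admissible submission set $\Pi$, ideal evaluator $E_T^*:\Pi\to\mathbb{R}^d$ and observed (possibly random) evaluator $\widehat E_T:\Pi\to\mathbb{R}^d$; let $F_0\subset\mathbb{R}^d$ be the finite public frontier used for grading, $r\in\mathbb{R}^d$ the reference point, and $\mathfrak{A}_{\mathrm{priv}}$ a declared envelope of private AI-only protocols. Assume that $F_0$ is $\varepsilon_{\mathrm{bud}}$-saturated against $\mathfrak{A}_{\mathrm{priv}}$, i.e. \[ \sup_{\mathcal{A}\in\mathfrak{A}_{\mathrm{priv}}}\big[\operatorname{HV}(F_0\cup S^*(\mathcal{A});r)-\operatorname{HV}(F_0;r)\big]\le\varepsilon_{\mathrm{bud}}, \] and that the evaluator satisfies the uniform one-sided hypervolume error bound \[ \widehat\delta_T(\pi;F_0)\le\delta_T^*(\pi;F_0)+\varepsilon_{\mathrm{eval}}\quad\text{for every admissible submission }\pi\text{ considered in grading}, \] where, if the evaluator is randomized, this bound is assumed to hold (simultaneously for all such $\pi$) at a stated confidence level, i.e. with probability at least $1-\alpha$. Let $\eta_T=\varepsilon_{\mathrm{bud}}+\varepsilon_{\mathrm{eval}}$, and let the thresholded grade be \[ G_T^{\eta}(\pi)=g_{\mathrm{AI}}+\phi\big([\widehat\delta_T(\pi;F_0)-\eta_T]_+\big), \] where $g_{\mathrm{AI}}\in\mathbb{R}$ and $\phi:\mathbb{R}_{\ge0}\to\mathbb{R}_{\ge0}$ is monotone with $\phi(0)=0$. Then: (i) at the stated confidence level of the error bound (with probability at least $1-\alpha$, or surely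 if the bound is deterministic), every AI-only submission inside the declared envelope, i.e. every $\pi\in\Pi^*(\mathcal{A})$ with $\mathcal{A}\in\mathfrak{A}_{\mathrm{priv}}$ that is considered in grading, receives no surplus grade above $g_{\mathrm{AI}}$: $G_T^{\eta}(\pi)\le g_{\mathrm{AI}}$; (ii) whenever the one-sided evaluator-error bound holds, every admissible submission $\pi$ considered in grading with $G_T^{\eta}(\pi)>g_{\mathrm{AI}}$ has ideal surplus \[ \delta_T^*(\pi;F_0)>\varepsilon_{\mathrm{bud}} . \]
   Context: Let $d\ge 1$. For a finite set $F\subset\mathbb{R}^d$ and $r\in\mathbb{R}^d$, the dominated hypervolume is \[ \operatorname{HV}(F;r)=\lambda_d\Big(\bigcup_{s\in F}[r_1,s_1]\times\cdots\times[r_d,s_d]\Big), \] with $\lambda_d$ Lebesgue measure on $\mathbb{R}^d$. Write $[x]_+=\max(x,0)$. $\Pi$ is the set of admissible submissions of the task. $E_T^*(\pi)\in\mathbb{R}^d$ is the ideal deterministic score of $\pi\in\Pi$ and $\widehat E_T(\pi)\in\mathbb{R}^d$ is its observed score, which may be random. Each protocol $\mathcal{A}\in\mathfrak{A}_{\mathrm{priv}}$ returns a finite set $\Pi^*(\mathcal{A})\subseteq\Pi$ of admissible submissions, with $S^*(\mathcal{A})=\{E_T^*(\pi):\pi\in\Pi^*(\mathcal{A})\}$. A submission $\pi$ is AI-only inside the declared envelope if $\pi\in\Pi^*(\mathcal{A})$ for some $\mathcal{A}\in\mathfrak{A}_{\mathrm{priv}}$. Ideal and observed surplus of $\pi\in\Pi$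 over $F_0$: \[ \delta_T^*(\pi;F_0)=\operatorname{HV}(F_0\cup\{E_T^*(\pi)\};r)-\operatorname{HV}(F_0;r),\qquad \widehat\delta_T(\pi;F_0)=\operatorname{HV}(F_0\cup\{\widehat E_T(\pi)\};r)-\operatorname{HV}(F_0;r). \] "Considered in grading" refers to a fixed set of admissible submissions (a subset of $\Pi$) to which the grading rule and the error bound are applied. $\varepsilon_{\mathrm{bud}}$ and $\varepsilon_{\mathrm{eval}}$ are real margins. *)

theory Defs
  imports "HOL-Probability.Probability"
begin

text \<open>A box \<open>cbox r s\<close> is empty as soon as \<open>s $ i < r $ i\<close> for some \<open>i\<close>, so points
  that do not dominate the reference point \<open>r\<close> contribute nothing.\<close>

definition HV :: "(real ^ 'd) set \<Rightarrow> real ^ 'd \<Rightarrow> real" where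
  "HV F r = measure lebesgue (\<Union>s\<in>F. cbox r s)"

text \<open>Used both with the ideal evaluator and with a realisation of the observed one.\<close>

definition surplus ::
  "('s \<Rightarrow> real ^ 'd) \<Rightarrow> (real ^ 'd) set \<Rightarrow> real ^ 'd \<Rightarrow> 's \<Rightarrow> real" where
  "surplus E F\<^sub>0 r \<pi> = HV (F\<^sub>0 \<union> {E \<pi>}) r - HV F\<^sub>0 r"

text \<open>\<open>out A\<close> is the finite set of submissions returned by the protocol \<open>A\<close>. The supremum is
  taken in the extended reals: over the type \<^typ>\<open>real\<close> it would be a junk value for an
  unbounded family and for an empty envelope.\<close>

definition saturated ::
  "('s \<Rightarrow> real ^ 'd) \<Rightarrow> ('p \<Rightarrow> 's set) \<Rightarrow> 'p set \<Rightarrow> (real ^ 'd) set \<Rightarrow> real ^ 'd \<Rightarrow> real \<Rightarrow> bool" where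
  "saturated E out Env F\<^sub>0 r \<epsilon> \<longleftrightarrow>
     (SUP A\<in>Env. ereal (HV (F\<^sub>0 \<union> E ` out A) r - HV F\<^sub>0 r)) \<le> ereal \<epsilon>"

definition error_bound ::
  "('s \<Rightarrow> real ^ 'd) \<Rightarrow> ('s \<Rightarrow> real ^ 'd) \<Rightarrow> 's set \<Rightarrow> (real ^ 'd) set \<Rightarrow> real ^ 'd \<Rightarrow> real \<Rightarrow> bool" where
  "error_bound E Eobs C F\<^sub>0 r \<epsilon> \<longleftrightarrow>
     (\<forall>\<pi>\<in>C. surplus Eobs F\<^sub>0 r \<pi> \<le> surplus E F\<^sub>0 r \<pi> + \<epsilon>)"

definition grade ::
  "real \<Rightarrow> (real \<Rightarrow> real) \<Rightarrow> real \<Rightarrow> ('s \<Rightarrow> real ^ 'd) \<Rightarrow> (real ^ 'd) set \<Rightarrow> real ^ 'd \<Rightarrow> 's \<Rightarrow> real" where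
  "grade g \<phi> \<eta> Eobs F\<^sub>0 r \<pi> = g + \<phi> (max (surplus Eobs F\<^sub>0 r \<pi> - \<eta>) 0)"

text \<open>The properties of interest quantify over a possibly uncountable set of submissions, so the
  set of outcomes satisfying them need not be measurable. ``With probability at least \<open>p\<close>''
  therefore asks for an event of that probability on which the property holds; for measurable
  properties this is the usual notion, as the lemma below shows.\<close>

definition with_prob_at_least :: "'w measure \<Rightarrow> real \<Rightarrow> ('w \<Rightarrow> bool) \<Rightarrow> bool" where
  "with_prob_at_least M p P \<longleftrightarrow> (\<exists>B\<in>sets M. p \<le> measure M B \<and> (\<forall>\<omega>\<in>B. P \<omega>))"

lemma (in prob_space) with_prob_at_least_iff:
  assumes "{\<omega> \<in> space M. P \<omega>} \<in> events"
  shows "with_prob_at_least M p P \<longleftrightarrow> p \<le> \<P>(\<omega> in M. P \<omega>)"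
proof
  assume "with_prob_at_least M p P"
  then obtain B where B: "B \<in> events" "p \<le> prob B" "\<forall>\<omega>\<in>B. P \<omega>"
    by (auto simp: with_prob_at_least_def)
  then have "B \<subseteq> {\<omega> \<in> space M. P \<omega>}"
    using sets.sets_into_space by blast
  then have "prob B \<le> \<P>(\<omega> in M. P \<omega>)"
    using assms by (rule finite_measure_mono)
  with B show "p \<le> \<P>(\<omega> in M. P \<omega>)" by simp
next
  assume "p \<le> \<P>(\<omega> in M. P \<omega>)"
  with assms show "with_prob_at_least M p P"
    unfolding with_prob_at_least_def by blast
qed

end

theory Submission
  imports Defs
begin

text \<open>Everything is decided outcome by outcome. A grade above \<open>g_AI\<close> forces the
  observed surplus above \<epsilon>_bud + \<epsilon>_eval (\<open>surplus_gt_of_grade_gt\<close>);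
  the error bound costs at most \<epsilon>_eval, so the ideal surplus exceeds \<epsilon>_bud, which
  is (ii). By monotonicity of hypervolume, saturation caps the ideal surplus of each AI-only
  submission at \<epsilon>_bud (\<open>surplus_le_of_saturated\<close>), so (i) follows from (ii) by
  contradiction. Probability enters only at the end, through
  \<open>with_prob_at_least_mono\<close>.\<close>

lemma HV_mono:
  fixes F G :: "(real ^ 'd) set"
  assumes "F \<subseteq> G" "finite G"
  shows "HV F r \<le> HV G r"
  unfolding HV_def
proof (rule measure_mono_fmeasurable)
  show "(\<Union>s\<in>F. cbox r s) \<subseteq> (\<Union>s\<in>G. cbox r s)"
    using assms(1) by blast
  have "finite F"
    using assms finite_subset by blast
  then show "(\<Union>s\<in>F. cbox r s) \<in> sets lebesgue"
    by (intro sets.finite_UN) auto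
  \<comment> \<open>\<open>measure\<close> is 0 on sets of infinite measure, so the larger union
    must have finite measure; a finite union of boxes does.\<close>
  show "(\<Union>s\<in>G. cbox r s) \<in> lmeasurable"
    using assms(2) by (intro fmeasurable.finite_UN) auto
qed

text \<open>One point of a protocol's score set adds no more hypervolume than the whole set, whose
  gain is one term of the supremum.\<close>

lemma surplus_le_of_saturated:
  assumes "saturated E out Env F r \<epsilon>" "A \<in> Env" "\<pi> \<in> out A" "finite F" "finite (out A)"
  shows "surplus E F r \<pi> \<le> \<epsilon>"
proof -
  have "HV (F \<union> {E \<pi>}) r \<le> HV (F \<union> E ` out A) r"
    using assms by (intro HV_mono) auto
  moreover have "ereal (HV (F \<union> E ` out A) r - HV F r) \<le> ereal \<epsilon>"
    using assms(1,2) unfolding saturated_def by (meson SUP_upper order_trans)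
  ultimately show ?thesis
    unfolding surplus_def by simp
qed

text \<open>Contrapositive: at or below the threshold the positive part is 0, and
  \<open>\<phi> 0 = 0\<close> leaves the grade equal to \<open>g\<close>.\<close>

lemma surplus_gt_of_grade_gt:
  assumes "grade g \<phi> \<eta> E F r \<pi> > g" "\<phi> 0 = 0"
  shows "surplus E F r \<pi> > \<eta>"
  using assms by (cases "surplus E F r \<pi> \<le> \<eta>") (auto simp: grade_def max_def split: if_splits)

lemma ideal_surplus_gt_of_grade_gt:
  assumes "error_bound E E' C F r \<epsilon>'" "\<pi> \<in> C"
    and "grade g \<phi> (\<epsilon> + \<epsilon>') E' F r \<pi> > g" "\<phi> 0 = 0"
  shows "surplus E F r \<pi> > \<epsilon>"
  using surplus_gt_of_grade_gt[OF assms(3,4)] assms(1,2) by (force simp: error_bound_def)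

text \<open>The event witnessing \<open>P\<close> also witnesses \<open>Q\<close>, so neither
  property has to be measurable.\<close>

lemma with_prob_at_least_mono:
  assumes "with_prob_at_least M p P" "\<And>\<omega>. P \<omega> \<Longrightarrow> Q \<omega>"
  shows "with_prob_at_least M p Q"
  using assms unfolding with_prob_at_least_def by blast

theorem theorem3:
  fixes Adm C :: "'s set"
    and Estar :: "'s \<Rightarrow> real ^ 'd"
    and M :: "'w measure"
    and Ehat :: "'w \<Rightarrow> 's \<Rightarrow> real ^ 'd"
    and F\<^sub>0 :: "(real ^ 'd) set"
    and r :: "real ^ 'd"
    and Env :: "'p set"
    and out :: "'p \<Rightarrow> 's set"
    and \<epsilon>_bud \<epsilon>_eval \<eta> \<alpha> g_AI :: real
    and \<phi> :: "real \<Rightarrow> real"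
  assumes "prob_space M"
    and "\<forall>\<pi>\<in>Adm. (\<lambda>\<omega>. Ehat \<omega> \<pi>) \<in> borel_measurable M"
    and "C \<subseteq> Adm"
    and "finite F\<^sub>0"
    and "\<forall>A\<in>Env. finite (out A) \<and> out A \<subseteq> Adm"
    and "saturated Estar out Env F\<^sub>0 r \<epsilon>_bud"
    and "\<eta> = \<epsilon>_bud + \<epsilon>_eval"
    and "\<phi> \<in> {0..} \<rightarrow> {0..}" and "mono_on {0..} \<phi>" and "\<phi> 0 = 0"
  shows
    "(with_prob_at_least M (1 - \<alpha>) (\<lambda>\<omega>. error_bound Estar (Ehat \<omega>) C F\<^sub>0 r \<epsilon>_eval) \<longrightarrow>
      with_prob_at_least M (1 - \<alpha>)
        (\<lambda>\<omega>. \<forall>A\<in>Env. \<forall>\<pi>\<in>out A \<inter> C. grade g_AI \<phi> \<eta> (Ehat \<omega>) F\<^sub>0 r \<pi> \<le> g_AI)) \<and>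
     ((\<forall>\<omega>\<in>space M. error_bound Estar (Ehat \<omega>) C F\<^sub>0 r \<epsilon>_eval) \<longrightarrow>
      (\<forall>\<omega>\<in>space M. \<forall>A\<in>Env. \<forall>\<pi>\<in>out A \<inter> C. grade g_AI \<phi> \<eta> (Ehat \<omega>) F\<^sub>0 r \<pi> \<le> g_AI)) \<and>
     (\<forall>\<omega>\<in>space M. error_bound Estar (Ehat \<omega>) C F\<^sub>0 r \<epsilon>_eval \<longrightarrow>
      (\<forall>\<pi>\<in>C. grade g_AI \<phi> \<eta> (Ehat \<omega>) F\<^sub>0 r \<pi> > g_AI \<longrightarrow> surplus Estar F\<^sub>0 r \<pi> > \<epsilon>_bud))"
proof -
  have ii: "surplus Estar F\<^sub>0 r \<pi> > \<epsilon>_bud"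
    if "error_bound Estar (Ehat \<omega>) C F\<^sub>0 r \<epsilon>_eval" "\<pi> \<in> C"
      "grade g_AI \<phi> \<eta> (Ehat \<omega>) F\<^sub>0 r \<pi> > g_AI" for \<omega> \<pi>
    using ideal_surplus_gt_of_grade_gt[OF that(1,2)] that(3) assms(7,10) by blast
  have i: "\<forall>A\<in>Env. \<forall>\<pi>\<in>out A \<inter> C. grade g_AI \<phi> \<eta> (Ehat \<omega>) F\<^sub>0 r \<pi> \<le> g_AI"
    if "error_bound Estar (Ehat \<omega>) C F\<^sub>0 r \<epsilon>_eval" for \<omega>
  proof (intro ballI)
    fix A \<pi> assume "A \<in> Env" "\<pi> \<in> out A \<inter> C"
    then have "surplus Estar F\<^sub>0 r \<pi> \<le> \<epsilon>_bud"
      using surplus_le_of_saturated[OF assms(6)] assms(4,5) by blast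
    then show "grade g_AI \<phi> \<eta> (Ehat \<omega>) F\<^sub>0 r \<pi> \<le> g_AI"
      \<comment> \<open>A grade above \<open>g_AI\<close> would give, by \<open>ii\<close>, an ideal
        surplus above \<epsilon>_bud, against the saturation bound just obtained.\<close>
      using ii[OF that] \<open>\<pi> \<in> out A \<inter> C\<close> by (meson IntD2 not_le)
  qed
  show ?thesis
    using i ii by (auto elim!: with_prob_at_least_mono)
qed

end
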